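(* Let $(G_N)_{N\in\mathbb N}$ be a spectral expander such that $N_1=N_1(N)$ satisfies $N_1/\ln N\to\infty$. Then for every $c>0$ there exists $\varepsilon>0$ such that for all sufficiently large $N$ and all integers $t>c\min\{\sqrt N,N_1\}$, $$\operatorname{mon}(C_t,G_N)<(1-\varepsilon)\operatorname{hom}(C_t,G_N).$$
   Context: $(G_N)_{N\in\mathbb N}$ is a sequence of graphs where $G_N$ has vertex set $\{1,\dots,N\}$ and is connected, non-bipartite and $N_1$-regular, with $N_1=N_1(N)$. Let $\lambda_1(N)$ be the largest in absolute value eigenvalue of the adjacency matrix of $G_N$ among those different from $N_1$. The sequence is called a spectral expander if there is $\delta>0$ such that $|\lambda_1|/N_1<1-\delta$ for all large $N$. $C_t$ is the cycle on $t$ vertices; $\operatorname{hom}(H,G)$ and $\operatorname{mon}(H,G)$ denote the numbers of homomorphisms (edge-preserving maps $V(H)\to V(G)$) and of injective homomorphisms from $H$ to $G$. *)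

theory Defs
  imports Complex_Main "HOL-Library.FuncSet" "Jordan_Normal_Form.Char_Poly"
begin

definition simple_graph_on :: "nat \<Rightarrow> (nat \<Rightarrow> nat \<Rightarrow> bool) \<Rightarrow> bool" where
  "simple_graph_on N E \<longleftrightarrow>
     (\<forall>u v. E u v \<longrightarrow> u \<in> {1..N} \<and> v \<in> {1..N}) \<and>
     (\<forall>u v. E u v \<longrightarrow> E v u) \<and> (\<forall>u. \<not> E u u)"

definition connected_on :: "nat \<Rightarrow> (nat \<Rightarrow> nat \<Rightarrow> bool) \<Rightarrow> bool" where
  "connected_on N E \<longleftrightarrow> (\<forall>u\<in>{1..N}. \<forall>v\<in>{1..N}. E\<^sup>*\<^sup>* u v)"

definition bipartite_on :: "nat \<Rightarrow> (nat \<Rightarrow> nat \<Rightarrow> bool) \<Rightarrow> bool" where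
  "bipartite_on N E \<longleftrightarrow> (\<exists>col :: nat \<Rightarrow> bool.
      \<forall>u\<in>{1..N}. \<forall>v\<in>{1..N}. E u v \<longrightarrow> col u \<noteq> col v)"

definition regular_on :: "nat \<Rightarrow> (nat \<Rightarrow> nat \<Rightarrow> bool) \<Rightarrow> nat \<Rightarrow> bool" where
  "regular_on N E d \<longleftrightarrow> (\<forall>v\<in>{1..N}. card {u\<in>{1..N}. E v u} = d)"

definition adj_mat :: "nat \<Rightarrow> (nat \<Rightarrow> nat \<Rightarrow> bool) \<Rightarrow> real mat" where
  "adj_mat N E = mat N N (\<lambda>(i,j). if E (Suc i) (Suc j) then 1 else 0)"

text \<open>Spectral expander: exists delta > 0 such that for all large N, every eigenvalue mu of
  the adjacency matrix different from the degree N1 N satisfies |mu| / N1 < 1 - delta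
  (equivalently, the largest such |mu|, i.e. |lambda_1|, does).\<close>
definition spectral_expander :: "(nat \<Rightarrow> nat \<Rightarrow> nat \<Rightarrow> bool) \<Rightarrow> (nat \<Rightarrow> nat) \<Rightarrow> bool" where
  "spectral_expander G N1 \<longleftrightarrow> (\<exists>\<delta>>0. \<forall>\<^sub>F N in sequentially.
      \<forall>\<mu>. eigenvalue (adj_mat N (G N)) \<mu> \<and> \<mu> \<noteq> real (N1 N) \<longrightarrow>
          \<bar>\<mu>\<bar> / real (N1 N) < 1 - \<delta>)"

definition cycle_graph :: "nat \<Rightarrow> nat \<Rightarrow> nat \<Rightarrow> bool" where
  "cycle_graph t i j \<longleftrightarrow> i < t \<and> j < t \<and> (j = Suc i mod t \<or> i = Suc j mod t)"

definition hom_count :: "'a set \<Rightarrow> ('a \<Rightarrow> 'a \<Rightarrow> bool) \<Rightarrow> 'b set \<Rightarrow> ('b \<Rightarrow> 'b \<Rightarrow> bool) \<Rightarrow> nat" where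
  "hom_count VH H VG G = card {f \<in> VH \<rightarrow>\<^sub>E VG. \<forall>x\<in>VH. \<forall>y\<in>VH. H x y \<longrightarrow> G (f x) (f y)}"

definition mon_count :: "'a set \<Rightarrow> ('a \<Rightarrow> 'a \<Rightarrow> bool) \<Rightarrow> 'b set \<Rightarrow> ('b \<Rightarrow> 'b \<Rightarrow> bool) \<Rightarrow> nat" where
  "mon_count VH H VG G = card {f \<in> VH \<rightarrow>\<^sub>E VG. inj_on f VH \<and>
      (\<forall>x\<in>VH. \<forall>y\<in>VH. H x y \<longrightarrow> G (f x) (f y))}"

end

theory Submission
  imports Defs "HOL-Analysis.Function_Topology" "HOL-Analysis.Convex" "HOL-Real_Asymp.Real_Asymp"
begin

text \<open>
  By the spectral gap the number of walks of length \<open>k\<close> between two given vertices is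
  \<open>(1 + o(1)) d\<^sup>k / N\<close> once \<open>k\<close> exceeds a large multiple of \<open>ln N\<close>, so a segment of that length
  decouples its endpoints; in particular there are \<open>(1 + o(1)) d\<^sup>t\<close> closed walks of length \<open>t\<close>.
  If \<open>t > c d\<close>, an injective closed walk never backtracks, which costs a factor
  \<open>(1 - 1/d)\<^sup>n\<close> with \<open>n\<close> of order \<open>t\<close>, hence a constant below 1. If \<open>t > c sqrt N\<close>, the first quarter
  of an injective walk occupies a set \<open>S\<close> of \<open>m\<close> vertices, of order at least \<open>sqrt N\<close>, that the third
  quarter has to avoid; each of its steps avoids \<open>S\<close> at the cost of a factor
  \<open>sqrt (1 - \<delta> m / N)\<close>, again a constant factor below 1 in total.
\<close>

subsection \<open>Spectral gap\<close>

text \<open>For small \<open>s\<close> the linear term outweighs the quadratic one and takes both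
  signs. This is the first-order condition at a maximum, used to identify the maximiser in
  \<open>spectral_gap\<close>.\<close>

lemma linear_term_zero:
  fixes b q :: real
  assumes "\<And>s. 0 \<le> s * b + s\<^sup>2 * q"
  shows "b = 0"
proof (rule ccontr)
  assume "b \<noteq> 0"
  define r where "r = 1 + \<bar>q\<bar>"
  have r: "r > 0" "q < r" unfolding r_def by auto
  have "(- b / r) * b + (- b / r)\<^sup>2 * q = (b / r)\<^sup>2 * (q - r)"
    using r by (simp add: field_simps power2_eq_square)
  moreover have "(b / r)\<^sup>2 * (q - r) < 0"
    using r \<open>b \<noteq> 0\<close> by (intro mult_pos_neg) auto
  ultimately show False using assms[of "- b / r"] by linarith
qed

locale regular_graph =
  fixes V :: "'a set" and E :: "'a \<Rightarrow> 'a \<Rightarrow> bool" and d :: nat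
  assumes finite_V: "finite V"
    and edge_V: "E u v \<Longrightarrow> u \<in> V \<and> v \<in> V"
    and edge_sym: "E u v \<Longrightarrow> E v u"
    and degree: "u \<in> V \<Longrightarrow> card {v. E u v} = d"
begin

text \<open>Summing over all of \<open>V\<close> with 0-1 weights, rather than over neighbours,
  makes exchanging sums and continuity in \<open>f\<close> immediate; \<open>adj_eq\<close> gives
  the other form.\<close>

definition adj :: "('a \<Rightarrow> real) \<Rightarrow> 'a \<Rightarrow> real" where
  "adj f u = (\<Sum>v\<in>V. of_bool (E u v) * f v)"

definition nsq :: "('a \<Rightarrow> real) \<Rightarrow> real" where
  "nsq f = (\<Sum>v\<in>V. (f v)\<^sup>2)"

lemma finite_nbrs: "finite {v. E u v}"
  by (rule finite_subset[OF _ finite_V]) (auto dest: edge_V)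

lemma adj_eq: "adj f u = (\<Sum>v | E u v. f v)"
  unfolding adj_def
  by (rule sum.mono_neutral_cong_right) (auto simp: finite_V dest: edge_V)

lemma adj_const: "u \<in> V \<Longrightarrow> adj (\<lambda>_. a) u = real d * a"
  by (simp add: adj_eq degree)

lemma adj_add: "adj (\<lambda>v. f v + g v) u = adj f u + adj g u"
  by (simp add: adj_eq sum.distrib)

lemma adj_diff: "adj (\<lambda>v. f v - g v) u = adj f u - adj g u"
  by (simp add: adj_eq sum_subtractf)

lemma adj_cmult: "adj (\<lambda>v. a * f v) u = a * adj f u"
  by (simp add: adj_eq sum_distrib_left)

lemma adj_cong: "(\<And>v. v \<in> V \<Longrightarrow> f v = g v) \<Longrightarrow> adj f u = adj g u"
  unfolding adj_def by (rule sum.cong) auto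

lemma adj_symmetric: "(\<Sum>u\<in>V. adj f u * g u) = (\<Sum>u\<in>V. f u * adj g u)"
proof -
  have "(\<Sum>u\<in>V. adj f u * g u) = (\<Sum>u\<in>V. \<Sum>v\<in>V. of_bool (E u v) * f v * g u)"
    by (simp add: adj_def sum_distrib_right)
  also have "\<dots> = (\<Sum>v\<in>V. \<Sum>u\<in>V. of_bool (E u v) * f v * g u)"
    by (rule sum.swap)
  also have "\<dots> = (\<Sum>v\<in>V. f v * adj g v)"
    unfolding adj_def sum_distrib_left
    by (intro sum.cong refl) (auto intro: edge_sym)
  finally show ?thesis .
qed

lemma sum_adj: "sum (adj f) V = real d * sum f V"
  using adj_symmetric[of f "\<lambda>_. 1"] by (simp add: adj_const sum_distrib_left mult.commute)

lemma nsq_nonneg: "0 \<le> nsq f"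
  unfolding nsq_def by (rule sum_nonneg) auto

lemma nsq_zero_iff: "nsq f = 0 \<longleftrightarrow> (\<forall>v\<in>V. f v = 0)"
  unfolding nsq_def using finite_V by (simp add: sum_nonneg_eq_0_iff)

lemma nsq_cmult: "nsq (\<lambda>v. a * f v) = a\<^sup>2 * nsq f"
  by (simp add: nsq_def power_mult_distrib sum_distrib_left)

lemma nsq_cong: "(\<And>v. v \<in> V \<Longrightarrow> f v = g v) \<Longrightarrow> nsq f = nsq g"
  unfolding nsq_def by (rule sum.cong) auto

lemma nsq_add: "nsq (\<lambda>v. f v + g v) = nsq f + 2 * (\<Sum>v\<in>V. f v * g v) + nsq g"
  by (simp add: nsq_def power2_sum sum.distrib sum_distrib_left mult.assoc)

lemma sq_le_nsq: "v \<in> V \<Longrightarrow> (f v)\<^sup>2 \<le> nsq f"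
  unfolding nsq_def using finite_V by (intro member_le_sum) auto

text \<open>Requiring functions to vanish off \<open>V\<close> puts the sphere inside a product of
  intervals and singletons, which is compact by Tychonoff. The two remaining conditions involve
  finitely many coordinates, hence are closed.\<close>

lemma compact_unit_sphere:
  "compact {f. (\<forall>v. v \<notin> V \<longrightarrow> f v = 0) \<and> sum f V = 0 \<and> nsq f = 1}" (is "compact ?K")
proof -
  define C where "C = PiE UNIV (\<lambda>v. if v \<in> V then {-1..1::real} else {0})"
  have "compact C"
    unfolding C_def compactin_euclidean_iff[symmetric] euclidean_product_topology[symmetric]
    by (auto simp: compactin_PiE)
  moreover have "closed {f :: 'a \<Rightarrow> real. sum f V = 0}"
    by (intro closed_Collect_eq continuous_intros continuous_on_product_coordinates)
  moreover have "closed {f. nsq f = 1}"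
    unfolding nsq_def
    by (intro closed_Collect_eq continuous_intros continuous_on_product_coordinates)
  ultimately have "compact (C \<inter> {f. sum f V = 0} \<inter> {f. nsq f = 1})"
    by (intro compact_Int_closed)
  also have "C \<inter> {f. sum f V = 0} \<inter> {f. nsq f = 1} = ?K"
  proof -
    have "f v \<in> {-1..1}" if "nsq f = 1" "v \<in> V" for f v
      using sq_le_nsq[OF that(2), of f] that(1) by (simp add: abs_square_le_1 abs_le_iff)
    then show ?thesis
      unfolding C_def by (auto simp: PiE_iff) (metis singletonD)
  qed
  finally show ?thesis .
qed

text \<open>A continuous function attains its maximum on the compact sphere, and rescaling extends
  the bound to all mean-zero functions. The alternative \<open>M = 0\<close> covers an empty sphere,
  that is, at most one vertex.\<close>

lemma adj_operator_norm_attained: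
  obtains M where "M \<ge> 0" "\<And>f. sum f V = 0 \<Longrightarrow> nsq (adj f) \<le> M * nsq f"
    "M = 0 \<or> (\<exists>g. sum g V = 0 \<and> nsq g = 1 \<and> nsq (adj g) = M)"
proof -
  let ?K = "{f. (\<forall>v. v \<notin> V \<longrightarrow> f v = 0) \<and> sum f V = 0 \<and> nsq f = 1}"
  have scale: "nsq (adj f) \<le> M * nsq f"
    if M: "\<And>g. g \<in> ?K \<Longrightarrow> nsq (adj g) \<le> M" and f: "sum f V = 0" for M f
  proof (cases "nsq f = 0")
    case True
    then have "adj f u = 0" for u
      unfolding nsq_zero_iff adj_def by (intro sum.neutral) auto
    then show ?thesis using True by (simp add: nsq_def)
  next
    case False
    with nsq_nonneg[of f] have pos: "nsq f > 0" by linarith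
    define a where "a = 1 / sqrt (nsq f)"
    define g where "g v = (if v \<in> V then a * f v else 0)" for v
    have a: "a\<^sup>2 * nsq f = 1"
      using pos by (simp add: a_def power_divide)
    have "nsq g = nsq (\<lambda>v. a * f v)" by (rule nsq_cong) (simp add: g_def)
    moreover have "sum g V = a * sum f V"
      by (simp add: g_def sum_distrib_left)
    ultimately have "g \<in> ?K"
      using a f by (auto simp: nsq_cmult) (simp add: g_def)
    moreover have "adj g u = a * adj f u" for u
      unfolding adj_cmult[symmetric] by (rule adj_cong) (simp add: g_def)
    then have "nsq (adj g) = a\<^sup>2 * nsq (adj f)"
      using nsq_cmult[of a "adj f"] by (simp add: nsq_def)
    ultimately have "a\<^sup>2 * nsq (adj f) \<le> M" using M[of g] by simp
    then have "a\<^sup>2 * nsq (adj f) * nsq f \<le> M * nsq f"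
      using pos by (intro mult_right_mono) auto
    moreover have "a\<^sup>2 * nsq (adj f) * nsq f = nsq (adj f) * (a\<^sup>2 * nsq f)"
      by (simp only: mult_ac)
    ultimately show ?thesis by (simp only: a mult_1_right)
  qed
  show ?thesis
  proof (cases "?K = {}")
    case True
    have "nsq (adj f) \<le> 0 * nsq f" if "sum f V = 0" for f
      by (rule scale[OF _ that]) (use True in blast)
    then show ?thesis by (intro that[of 0]) auto
  next
    case False
    have "continuous_on ?K (\<lambda>f. nsq (adj f))"
      unfolding nsq_def adj_def
      by (intro continuous_intros
          continuous_on_subset[OF continuous_on_product_coordinates subset_UNIV])
    from continuous_attains_sup[OF compact_unit_sphere False this]
    obtain g where g: "g \<in> ?K" "\<And>f. f \<in> ?K \<Longrightarrow> nsq (adj f) \<le> nsq (adj g)"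
      by auto
    show ?thesis
    proof (rule that[of "nsq (adj g)"])
      show "nsq (adj f) \<le> nsq (adj g) * nsq f" if "sum f V = 0" for f
        using g(2) that by (rule scale)
      show "nsq (adj g) = 0 \<or> (\<exists>g'. sum g' V = 0 \<and> nsq g' = 1 \<and> nsq (adj g') = nsq (adj g))"
        using g(1) by blast
    qed (rule nsq_nonneg)
  qed
qed

end

text \<open>The spectral hypothesis is phrased through real eigenfunctions of mean zero, those
  orthogonal to the constants, so that neither matrices nor an ordering of the eigenvalues enter the
  argument.\<close>

locale expander_graph = regular_graph +
  fixes \<delta> :: real
  assumes delta: "0 < \<delta>" "\<delta> \<le> 1" and nonempty: "V \<noteq> {}" and degree_pos: "d > 0"
    and eigenvalue_bound: "\<And>f \<mu> v. sum f V = 0 \<Longrightarrow> v \<in> V \<Longrightarrow> f v \<noteq> 0 \<Longrightarrow>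
      (\<And>u. u \<in> V \<Longrightarrow> adj f u = \<mu> * f u) \<Longrightarrow> \<bar>\<mu>\<bar> \<le> (1 - \<delta>) * real d"
begin

abbreviation \<rho> :: real where "\<rho> \<equiv> 1 - \<delta>"

text \<open>Write A for \<open>adj\<close>. A maximiser g of the squared norm of A g on the
  mean-zero sphere satisfies A^2 g = M g, that is, (A - \<sigma>)(A + \<sigma>) g = 0 with \<sigma>
  = sqrt M. So \<sigma> or -\<sigma> has a mean-zero eigenfunction, and the eigenvalue bound
  controls M.\<close>

lemma spectral_gap:
  assumes f: "sum f V = 0"
  shows "nsq (adj f) \<le> (\<rho> * real d)\<^sup>2 * nsq f"
proof -
  obtain M where M: "M \<ge> 0" "\<And>f. sum f V = 0 \<Longrightarrow> nsq (adj f) \<le> M * nsq f"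
    "M = 0 \<or> (\<exists>g. sum g V = 0 \<and> nsq g = 1 \<and> nsq (adj g) = M)"
    using adj_operator_norm_attained by blast
  have "M \<le> (\<rho> * real d)\<^sup>2"
  proof (cases "M = 0")
    case False
    then obtain g where g: "sum g V = 0" "nsq g = 1" "nsq (adj g) = M"
      using M(3) by auto
    \<comment> \<open>\<open>h\<close> is the defect in A^2 g = M g. It also serves as the direction
      of perturbation, so that the first-order term is a multiple of \<open>nsq h\<close>
      itself.\<close>
    define h where "h v = M * g v - adj (adj g) v" for v
    have sum_h: "sum h V = 0"
      by (simp add: h_def sum_subtractf sum_distrib_left[symmetric] sum_adj g)
    have ip_gh: "M * (\<Sum>v\<in>V. g v * h v) - (\<Sum>v\<in>V. adj g v * adj h v) = nsq h"
    proof -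
      have "nsq h = (\<Sum>v\<in>V. M * g v * h v - adj (adj g) v * h v)"
        unfolding nsq_def by (intro sum.cong refl) (simp add: h_def power2_eq_square algebra_simps)
      also have "\<dots> = M * (\<Sum>v\<in>V. g v * h v) - (\<Sum>v\<in>V. adj (adj g) v * h v)"
        by (simp add: sum_subtractf sum_distrib_left mult.assoc)
      finally show ?thesis by (simp add: adj_symmetric)
    qed
    have "2 * nsq h = 0"
    proof (rule linear_term_zero[where q = "M * nsq h - nsq (adj h)"])
      fix s :: real
      let ?f = "\<lambda>v. g v + s * h v"
      have "sum ?f V = 0" using g sum_h by (simp add: sum.distrib sum_distrib_left[symmetric])
      then have "nsq (adj ?f) \<le> M * nsq ?f" by (rule M(2))
      moreover have "nsq (adj ?f) = M + 2 * s * (\<Sum>v\<in>V. adj g v * adj h v) + s\<^sup>2 * nsq (adj h)"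
      proof -
        have "adj ?f = (\<lambda>u. adj g u + s * adj h u)" by (simp add: adj_add adj_cmult fun_eq_iff)
        then show ?thesis
          by (simp add: nsq_add nsq_cmult g sum_distrib_left mult_ac)
      qed
      moreover have "nsq ?f = 1 + 2 * s * (\<Sum>v\<in>V. g v * h v) + s\<^sup>2 * nsq h"
        by (simp add: nsq_add nsq_cmult g sum_distrib_left mult_ac)
      ultimately have "0 \<le> 2 * s * (M * (\<Sum>v\<in>V. g v * h v) - (\<Sum>v\<in>V. adj g v * adj h v))
          + s\<^sup>2 * (M * nsq h - nsq (adj h))"
        by (simp add: algebra_simps)
      then show "0 \<le> s * (2 * nsq h) + s\<^sup>2 * (M * nsq h - nsq (adj h))"
        unfolding ip_gh by (simp add: mult_ac)
    qed
    then have sq_eigen: "adj (adj g) v = M * g v" if "v \<in> V" for v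
      using that by (simp add: nsq_zero_iff h_def)
    define \<sigma> where "\<sigma> = sqrt M"
    have \<sigma>: "\<sigma> \<ge> 0" "M = \<sigma>\<^sup>2" using M(1) by (auto simp: \<sigma>_def)
    \<comment> \<open>If \<open>k\<close> vanishes, \<open>g\<close> has eigenvalue
      \<open>- \<sigma>\<close>; otherwise \<open>k\<close> is an eigenfunction for
      \<open>\<sigma>\<close>.\<close>
    define k where "k v = adj g v + \<sigma> * g v" for v
    have "\<exists>\<mu>. \<bar>\<mu>\<bar> = \<sigma> \<and> \<bar>\<mu>\<bar> \<le> \<rho> * real d"
    proof (cases "\<forall>v\<in>V. k v = 0")
      case True
      obtain v where v: "v \<in> V" "g v \<noteq> 0"
        using g(2) nsq_zero_iff[of g] by auto
      have "\<bar>- \<sigma>\<bar> \<le> \<rho> * real d"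
        by (rule eigenvalue_bound[OF g(1) v]) (use True in \<open>auto simp: k_def eq_neg_iff_add_eq_0\<close>)
      then show ?thesis using \<sigma> by (intro exI[of _ "- \<sigma>"]) auto
    next
      case False
      then obtain v where v: "v \<in> V" "k v \<noteq> 0" by auto
      have "sum k V = 0"
        by (simp add: k_def sum.distrib sum_distrib_left[symmetric] sum_adj g)
      moreover have "adj k u = \<sigma> * k u" if "u \<in> V" for u
        unfolding k_def using sq_eigen[OF that] \<sigma>
        by (simp add: adj_add adj_cmult power2_eq_square algebra_simps)
      ultimately have "\<bar>\<sigma>\<bar> \<le> \<rho> * real d"
        using v by (intro eigenvalue_bound[of k v]) auto
      then show ?thesis using \<sigma> by (intro exI[of _ "\<sigma>"]) auto
    qed
    then show ?thesis using \<sigma> by (auto intro!: power_mono)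
  qed auto
  then have "M * nsq f \<le> (\<rho> * real d)\<^sup>2 * nsq f"
    by (intro mult_right_mono nsq_nonneg)
  then show ?thesis using M(2)[OF f] by linarith
qed

text \<open>Split off the mean \<open>a\<close> of \<open>f\<close>: the constant part is stretched by \<open>d\<close>, the rest by at most
  \<open>\<rho> d\<close>. When \<open>f\<close> vanishes on \<open>S\<close>, Cauchy-Schwarz limits the share of the constant part.\<close>
lemma nsq_adj_vanishing_on:
  assumes S: "S \<subseteq> V" and f: "\<And>v. v \<in> S \<Longrightarrow> f v = 0"
  shows "nsq (adj f) \<le> (real d)\<^sup>2 * (1 - \<delta> * card S / card V) * nsq f"
proof -
  let ?N = "real (card V)"
  have N: "?N > 0" using nonempty finite_V by (simp add: card_gt_0_iff)
  define a where "a = sum f V / ?N"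
  define g where "g v = f v - a" for v
  have sum_g: "sum g V = 0" using N by (simp add: g_def sum_subtractf a_def)
  have fg: "f = (\<lambda>v. a + g v)" by (simp add: g_def)
  have nsq_f: "nsq f = ?N * a\<^sup>2 + nsq g"
    by (subst fg, subst nsq_add) (simp add: nsq_def sum_distrib_left[symmetric] sum_g)
  have "nsq (adj f) = nsq (\<lambda>v. real d * a + adj g v)"
    by (rule nsq_cong, subst fg) (simp add: adj_add adj_const)
  also have "\<dots> = (real d)\<^sup>2 * (?N * a\<^sup>2) + nsq (adj g)"
    by (subst nsq_add) (simp add: nsq_def sum_distrib_left[symmetric] sum_adj sum_g power_mult_distrib)
  also have "\<dots> \<le> (real d)\<^sup>2 * (?N * a\<^sup>2) + (\<rho> * real d)\<^sup>2 * nsq g"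
    using spectral_gap[OF sum_g] by simp
  \<comment> \<open>Weakening the square of \<rho> to \<rho> = 1 - \<delta> lets the two parts
    recombine into \<rho> times \<open>nsq f\<close> plus \<delta> times the constant part.\<close>
  also have "\<dots> \<le> (real d)\<^sup>2 * (?N * a\<^sup>2) + (\<rho> * (real d)\<^sup>2) * nsq g"
  proof -
    have "\<rho>\<^sup>2 \<le> \<rho>" using delta by (simp add: power2_eq_square mult_left_le)
    then show ?thesis
      by (intro add_left_mono mult_right_mono nsq_nonneg) (simp add: power_mult_distrib mult_right_mono)
  qed
  also have "\<dots> = (real d)\<^sup>2 * (\<rho> * nsq f + \<delta> * (?N * a\<^sup>2))"
    by (simp add: nsq_f algebra_simps)
  also have "\<dots> \<le> (real d)\<^sup>2 * (\<rho> * nsq f + \<delta> * ((1 - card S / ?N) * nsq f))"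
  proof -
    have "sum f V = (\<Sum>v\<in>V - S. f v * 1)"
      using f S finite_V by (auto intro!: sum.mono_neutral_right)
    then have "(sum f V)\<^sup>2 \<le> (\<Sum>v\<in>V - S. (f v)\<^sup>2) * (\<Sum>v\<in>V - S. 1\<^sup>2)"
      using Cauchy_Schwarz_ineq_sum[of f "\<lambda>_. 1" "V - S"] by simp
    also have "\<dots> \<le> nsq f * real (card (V - S))"
      unfolding nsq_def using finite_V
      by (simp, intro mult_right_mono sum_mono2) auto
    also have "\<dots> = nsq f * (?N - card S)"
      using S finite_V by (simp add: card_Diff_subset finite_subset card_mono of_nat_diff)
    finally have "?N * a\<^sup>2 \<le> (1 - card S / ?N) * nsq f"
      using N by (simp add: a_def power2_eq_square field_simps)
    then show ?thesis using delta by (intro mult_left_mono add_left_mono) auto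
  qed
  also have "\<dots> = (real d)\<^sup>2 * (1 - \<delta> * card S / card V) * nsq f"
    by (simp add: algebra_simps)
  finally show ?thesis .
qed

end

subsection \<open>Walk counts\<close>

text \<open>The start \<open>u\<close> is kept apart from the list, so that the length of the list
  is the number of steps and walks concatenate without overlap.\<close>

fun path :: "('a \<Rightarrow> 'a \<Rightarrow> bool) \<Rightarrow> 'a \<Rightarrow> 'a list \<Rightarrow> bool" where
  "path E u [] \<longleftrightarrow> True"
| "path E u (x # xs) \<longleftrightarrow> E u x \<and> path E x xs"

lemma path_append: "path E u (xs @ ys) \<longleftrightarrow> path E u xs \<and> path E (last (u # xs)) ys"
  by (induction xs arbitrary: u) auto

lemma path_conv_nth: "path E u xs \<longleftrightarrow> (\<forall>i<length xs. E ((u # xs) ! i) (xs ! i))"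
proof (induction xs arbitrary: u)
  case (Cons x xs)
  then show ?case by (auto simp: nth_Cons' less_Suc_eq_0_disj)
qed auto

text \<open>A closed path based at \<open>u\<close> records the vertices after \<open>u\<close>, hence ends with \<open>u\<close> itself.\<close>
lemma closed_path_conv_nth:
  assumes "xs \<noteq> []"
  shows "path E (last xs) xs \<longleftrightarrow> (\<forall>i<length xs. E (xs ! i) (xs ! (Suc i mod length xs)))"
proof -
  obtain n where n: "length xs = Suc n" using assms by (cases xs) auto
  have "(\<forall>i<Suc n. E ((last xs # xs) ! i) (xs ! i)) \<longleftrightarrow>
      E (last xs) (xs ! 0) \<and> (\<forall>i<n. E (xs ! i) (xs ! Suc i))"
    by (auto simp: less_Suc_eq_0_disj nth_Cons')
  also have "\<dots> \<longleftrightarrow> (\<forall>i<Suc n. E (xs ! i) (xs ! (Suc i mod Suc n)))"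
    using assms n by (auto simp: All_less_Suc last_conv_nth)
  finally show ?thesis by (simp add: path_conv_nth n)
qed

context regular_graph
begin

text \<open>The predicate \<open>Q\<close> carries endpoint, distinctness and avoidance conditions
  alike, and in recursions it absorbs the vertices already visited.\<close>

definition paths :: "'a \<Rightarrow> nat \<Rightarrow> ('a list \<Rightarrow> bool) \<Rightarrow> 'a list set" where
  "paths u k Q = {xs. length xs = k \<and> path E u xs \<and> Q xs}"

lemma path_set: "path E u xs \<Longrightarrow> set xs \<subseteq> V"
  by (induction xs arbitrary: u) (auto dest: edge_V)

lemma path_last: "u \<in> V \<Longrightarrow> path E u xs \<Longrightarrow> last (u # xs) \<in> V"
  using path_set[of u xs] by auto

lemma finite_paths: "finite (paths u k Q)"
  by (rule finite_subset[OF _ finite_lists_length_eq[OF finite_V, of k]])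
    (auto simp: paths_def dest: path_set)

lemma paths_0: "paths u 0 Q = (if Q [] then {[]} else {})"
  by (auto simp: paths_def)

lemma card_paths_Suc:
  "card (paths u (Suc k) Q) = (\<Sum>x | E u x. card (paths x k (\<lambda>xs. Q (x # xs))))"
proof -
  have "paths u (Suc k) Q = (\<Union>x\<in>{x. E u x}. (#) x ` paths x k (\<lambda>xs. Q (x # xs)))"
    by (auto simp: paths_def length_Suc_conv)
  also have "card \<dots> = (\<Sum>x | E u x. card ((#) x ` paths x k (\<lambda>xs. Q (x # xs))))"
    by (rule card_UN_disjoint) (auto simp: finite_nbrs finite_paths)
  finally show ?thesis by (simp add: card_image)
qed

text \<open>Cut the walk after \<open>m\<close> steps. The condition \<open>Q\<close> on the whole
  is relaxed to \<open>R\<close> on the first piece and to \<open>T\<close> on the second, which may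
  depend on the first; hence only an upper bound.\<close>

lemma card_paths_append_le:
  assumes "\<And>as bs. length as = m \<Longrightarrow> length bs = n \<Longrightarrow> path E u as \<Longrightarrow> Q (as @ bs) \<Longrightarrow> R as \<and> T as bs"
  shows "card (paths u (m + n) Q) \<le> (\<Sum>as\<in>paths u m R. card (paths (last (u # as)) n (T as)))"
proof -
  let ?U = "\<Union>as\<in>paths u m R. (@) as ` paths (last (u # as)) n (T as)"
  have "paths u (m + n) Q \<subseteq> ?U"
  proof
    fix xs assume xs: "xs \<in> paths u (m + n) Q"
    define as bs where "as = take m xs" and "bs = drop m xs"
    have split: "xs = as @ bs" "length as = m" "length bs = n"
      using xs by (auto simp: as_def bs_def paths_def)
    have "path E u as" "path E (last (u # as)) bs" "Q (as @ bs)"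
      using xs unfolding split(1) paths_def mem_Collect_eq path_append by blast+
    with split(2,3) assms[of as bs]
    have "as \<in> paths u m R" "bs \<in> paths (last (u # as)) n (T as)"
      unfolding paths_def by blast+
    then show "xs \<in> ?U" unfolding split(1) by blast
  qed
  then have "card (paths u (m + n) Q) \<le> card ?U"
    by (intro card_mono finite_UN_I finite_imageI finite_paths)
  also have "\<dots> \<le> (\<Sum>as\<in>paths u m R. card ((@) as ` paths (last (u # as)) n (T as)))"
    by (rule card_UN_le) (rule finite_paths)
  also have "\<dots> \<le> (\<Sum>as\<in>paths u m R. card (paths (last (u # as)) n (T as)))"
    by (intro sum_mono card_image_le finite_paths)
  finally show ?thesis .
qed

lemma card_paths_mono: "(\<And>xs. Q xs \<Longrightarrow> R xs) \<Longrightarrow> card (paths u k Q) \<le> card (paths u k R)"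
  by (intro card_mono finite_paths) (auto simp: paths_def)

lemma card_paths_True: "u \<in> V \<Longrightarrow> card (paths u k (\<lambda>_. True)) = d ^ k"
proof (induction k arbitrary: u)
  case 0
  then show ?case by (simp add: paths_0)
next
  case (Suc k)
  have "card (paths u (Suc k) (\<lambda>_. True)) = (\<Sum>x | E u x. d ^ k)"
    unfolding card_paths_Suc by (rule sum.cong) (auto dest: edge_V simp: Suc.IH)
  then show ?case using Suc.prems by (simp add: degree)
qed

definition walks :: "nat \<Rightarrow> 'a \<Rightarrow> 'a \<Rightarrow> nat" where
  "walks k u v = card (paths u k (\<lambda>xs. last (u # xs) = v))"

lemma walks_eq_adj_pow: "real (walks k u v) = (adj ^^ k) (\<lambda>x. of_bool (x = v)) u"
proof (induction k arbitrary: u)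
  case 0
  then show ?case by (simp add: walks_def paths_0)
next
  case (Suc k)
  have "walks (Suc k) u v = (\<Sum>x | E u x. walks k x v)"
    unfolding walks_def card_paths_Suc by simp
  then show ?case by (simp add: Suc adj_eq)
qed

text \<open>Each step multiplies by the indicator of the complement of \<open>S\<close> and then
  applies \<open>adj\<close>. The start \<open>u\<close> may lie in \<open>S\<close>, since only
  later vertices are tested.\<close>

lemma card_paths_avoid:
  "real (card (paths u k (\<lambda>xs. set xs \<inter> S = {}))) =
    ((\<lambda>f. adj (\<lambda>x. of_bool (x \<notin> S) * f x)) ^^ k) (\<lambda>_. 1) u"
proof (induction k arbitrary: u)
  case 0
  then show ?case by (simp add: paths_0)
next
  case (Suc k)
  have "real (card (paths u (Suc k) (\<lambda>xs. set xs \<inter> S = {})))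
      = (\<Sum>x | E u x. real (card (paths x k (\<lambda>xs. set (x # xs) \<inter> S = {}))))"
    unfolding card_paths_Suc by simp
  also have "\<dots> = (\<Sum>x | E u x. of_bool (x \<notin> S) * real (card (paths x k (\<lambda>xs. set xs \<inter> S = {}))))"
    by (intro sum.cong refl) (auto simp: paths_def)
  finally show ?case by (simp add: Suc adj_eq)
qed

text \<open>Of the \<open>d\<close> neighbours of \<open>u\<close> the previous vertex
  \<open>p\<close> is barred. In the recursion the pair moves on to \<open>u\<close> and
  \<open>x\<close> and older vertices are forgotten, so only backtracking is excluded.\<close>

lemma card_paths_distinct_edge:
  "E p u \<Longrightarrow> card (paths u k (\<lambda>xs. distinct (p # u # xs))) \<le> (d - 1) ^ k"
proof (induction k arbitrary: p u)
  case 0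
  then show ?case by (simp add: paths_0)
next
  case (Suc k)
  let ?n = "\<lambda>x. card (paths x k (\<lambda>xs. distinct (p # u # x # xs)))"
  have "card (paths u (Suc k) (\<lambda>xs. distinct (p # u # xs))) = (\<Sum>x | E u x. ?n x)"
    unfolding card_paths_Suc by simp
  also have "\<dots> = (\<Sum>x\<in>{x. E u x} - {p}. ?n x)"
    by (rule sum.mono_neutral_right) (auto simp: finite_nbrs paths_def)
  also have "\<dots> \<le> (\<Sum>x\<in>{x. E u x} - {p}. (d - 1) ^ k)"
  proof (rule sum_mono)
    fix x assume "x \<in> {x. E u x} - {p}"
    then have "card (paths x k (\<lambda>xs. distinct (u # x # xs))) \<le> (d - 1) ^ k"
      by (intro Suc.IH) simp
    moreover have "?n x \<le> card (paths x k (\<lambda>xs. distinct (u # x # xs)))"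
      by (rule card_paths_mono) auto
    ultimately show "?n x \<le> (d - 1) ^ k" by linarith
  qed
  also have "\<dots> = (d - 1) * (d - 1) ^ k"
    using edge_sym[OF Suc.prems] edge_V[OF Suc.prems]
    by (simp add: finite_nbrs degree card_Diff_singleton)
  finally show ?case by simp
qed

lemma card_paths_distinct:
  assumes "u \<in> V"
  shows "card (paths u (Suc n) (\<lambda>xs. distinct (u # xs))) \<le> d * (d - 1) ^ n"
proof -
  have "card (paths u (Suc n) (\<lambda>xs. distinct (u # xs))) \<le> (\<Sum>x | E u x. (d - 1) ^ n)"
    unfolding card_paths_Suc by (intro sum_mono card_paths_distinct_edge) auto
  then show ?thesis using assms by (simp add: degree)
qed

text \<open>Distinctness is used only to forbid backtracking outside the closing segment.\<close>
lemma closed_distinct_le_nonbacktracking: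
  assumes "u \<in> V" "k > 0" and M: "\<And>w. w \<in> V \<Longrightarrow> real (walks k w u) \<le> M"
  shows "real (card (paths u (Suc n + k) (\<lambda>xs. last (u # xs) = u \<and> distinct xs)))
    \<le> real (d * (d - 1) ^ n) * M"
proof -
  let ?X = "paths u (Suc n) (\<lambda>xs. distinct (u # xs))"
  have M0: "0 \<le> M" using M[OF assms(1)] by simp
  have "card (paths u (Suc n + k) (\<lambda>xs. last (u # xs) = u \<and> distinct xs))
      \<le> (\<Sum>as\<in>?X. walks k (last (u # as)) u)"
    unfolding walks_def
  proof (rule card_paths_append_le, goal_cases)
    case (1 as bs)
    \<comment> \<open>The nonempty closing segment ends in \<open>u\<close>, so distinctness keeps
      \<open>u\<close> out of \<open>as\<close> and yields \<open>distinct (u # as)\<close>.\<close>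
    then have "bs \<noteq> []" using \<open>k > 0\<close> by auto
    then have "last bs \<in> set bs" by simp
    with 1 \<open>bs \<noteq> []\<close> show ?case by (auto split: if_splits)
  qed
  then have "real (card (paths u (Suc n + k) (\<lambda>xs. last (u # xs) = u \<and> distinct xs)))
      \<le> (\<Sum>as\<in>?X. real (walks k (last (u # as)) u))"
    unfolding of_nat_sum[symmetric] of_nat_le_iff .
  also have "\<dots> \<le> (\<Sum>as\<in>?X. M)"
    using assms(1) by (intro sum_mono M path_last) (auto simp: paths_def)
  also have "\<dots> \<le> real (d * (d - 1) ^ n) * M"
  proof -
    have "real (card ?X) \<le> real (d * (d - 1) ^ n)"
      using card_paths_distinct[OF assms(1)] by (rule of_nat_mono)
    then show ?thesis using M0 by (simp add: mult_right_mono del: of_nat_mult of_nat_power)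
  qed
  finally show ?thesis .
qed

text \<open>Distinctness is used only to keep the third of four segments away from the first; the second
  and the last segment decouple the endpoints.\<close>
lemma closed_distinct_le_avoiding:
  assumes u: "u \<in> V"
    and M1: "\<And>v w. v \<in> V \<Longrightarrow> w \<in> V \<Longrightarrow> real (walks k v w) \<le> M1"
    and M2: "\<And>w. w \<in> V \<Longrightarrow> real (walks r w u) \<le> M2"
    and Z: "\<And>S. S \<subseteq> V \<Longrightarrow> card S = m \<Longrightarrow>
      (\<Sum>w\<in>V. real (card (paths w n (\<lambda>xs. set xs \<inter> S = {})))) \<le> Z"
    and Z0: "0 \<le> Z"
  shows "real (card (paths u (m + (k + (n + r))) (\<lambda>xs. last (u # xs) = u \<and> distinct xs)))
    \<le> real (d ^ m) * (M1 * Z * M2)"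
proof -
  have M0: "0 \<le> M1" "0 \<le> M2" using M1[OF u u] M2[OF u] by linarith+
  \<comment> \<open>After the first \<open>m\<close> steps the remainder \<open>ys\<close> has
    \<open>k\<close> free steps, then \<open>n\<close> steps avoiding the first segment, then
    \<open>r\<close> steps back to \<open>u\<close>. \<open>?F\<close> counts what follows the free
    steps.\<close>
  let ?Q = "\<lambda>as ys. last (last (u # as) # ys) = u \<and> set (take n (drop k ys)) \<inter> set as = {}"
  let ?F = "\<lambda>S w. card (paths w (n + r) (\<lambda>ys. last (w # ys) = u \<and> set (take n ys) \<inter> S = {}))"
  let ?X = "paths u m distinct"
  have F: "real (?F S w) \<le> real (card (paths w n (\<lambda>xs. set xs \<inter> S = {}))) * M2"
    if "w \<in> V" for S w
  proof -
    have "?F S w \<le> (\<Sum>cs\<in>paths w n (\<lambda>xs. set xs \<inter> S = {}). walks r (last (w # cs)) u)"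
      unfolding walks_def by (rule card_paths_append_le) auto
    then have "real (?F S w) \<le> (\<Sum>cs\<in>paths w n (\<lambda>xs. set xs \<inter> S = {}). real (walks r (last (w # cs)) u))"
      unfolding of_nat_sum[symmetric] of_nat_le_iff .
    also have "\<dots> \<le> (\<Sum>cs\<in>paths w n (\<lambda>xs. set xs \<inter> S = {}). M2)"
      using that by (intro sum_mono M2 path_last) (auto simp: paths_def)
    finally show ?thesis by simp
  qed
  have G: "real (card (paths w (k + (n + r)) (?Q as))) \<le> M1 * Z * M2"
    if as: "as \<in> ?X" and w: "w = last (u # as)" for as w
  proof -
    have wV: "w \<in> V" using path_last[OF u] as w by (auto simp: paths_def)
    have S: "set as \<subseteq> V" "card (set as) = m"
      using as path_set by (auto simp: paths_def distinct_card)
    have "card (paths w (k + (n + r)) (?Q as)) \<le> (\<Sum>bs\<in>paths w k (\<lambda>_. True). ?F (set as) (last (w # bs)))"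
      by (rule card_paths_append_le) (auto simp: w)
    \<comment> \<open>Sorting the second segments by endpoint \<open>v\<close> turns their number
      into \<open>walks k w v\<close>, bounded by \<open>M1\<close> uniformly in \<open>v\<close>;
      the rest then sums over all \<open>v\<close>, as the bound \<open>Z\<close> requires.\<close>
    also have "\<dots> = (\<Sum>v\<in>V. \<Sum>bs\<in>{bs\<in>paths w k (\<lambda>_. True). last (w # bs) = v}. ?F (set as) (last (w # bs)))"
      by (rule sum.group[symmetric, OF finite_paths finite_V])
        (use path_last[OF wV] in \<open>unfold paths_def, blast\<close>)
    also have "\<dots> = (\<Sum>v\<in>V. walks k w v * ?F (set as) v)"
    proof (rule sum.cong[OF refl])
      fix v
      have "{bs\<in>paths w k (\<lambda>_. True). last (w # bs) = v} = paths w k (\<lambda>xs. last (w # xs) = v)"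
        unfolding paths_def by blast
      then have "(\<Sum>bs\<in>{bs\<in>paths w k (\<lambda>_. True). last (w # bs) = v}. ?F (set as) (last (w # bs)))
          = (\<Sum>bs\<in>paths w k (\<lambda>xs. last (w # xs) = v). ?F (set as) v)"
        by (rule sum.cong) (simp only: paths_def mem_Collect_eq)
      then show "(\<Sum>bs\<in>{bs\<in>paths w k (\<lambda>_. True). last (w # bs) = v}. ?F (set as) (last (w # bs)))
          = walks k w v * ?F (set as) v"
        unfolding walks_def by (simp only: sum_constant of_nat_id)
    qed
    finally have "real (card (paths w (k + (n + r)) (?Q as))) \<le> (\<Sum>v\<in>V. real (walks k w v) * real (?F (set as) v))"
      unfolding of_nat_mult[symmetric] of_nat_sum[symmetric] of_nat_le_iff .
    also have "\<dots> \<le> (\<Sum>v\<in>V. M1 * (real (card (paths v n (\<lambda>xs. set xs \<inter> set as = {}))) * M2))"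
      using wV M0 by (intro sum_mono mult_mono M1 F) auto
    also have "\<dots> = M1 * ((\<Sum>v\<in>V. real (card (paths v n (\<lambda>xs. set xs \<inter> set as = {})))) * M2)"
      by (simp add: sum_distrib_left sum_distrib_right)
    also have "\<dots> \<le> M1 * (Z * M2)"
      using M0 by (intro mult_left_mono mult_right_mono Z S)
    finally show ?thesis by (simp add: mult.assoc)
  qed
  have "card (paths u (m + (k + (n + r))) (\<lambda>xs. last (u # xs) = u \<and> distinct xs))
      \<le> (\<Sum>as\<in>?X. card (paths (last (u # as)) (k + (n + r)) (?Q as)))"
  proof (rule card_paths_append_le, goal_cases)
    case (1 as bs)
    have "set (take n (drop k bs)) \<subseteq> set bs" by (meson set_drop_subset set_take_subset order_trans)
    with 1 show ?case by (auto split: if_splits)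
  qed
  then have "real (card (paths u (m + (k + (n + r))) (\<lambda>xs. last (u # xs) = u \<and> distinct xs)))
      \<le> (\<Sum>as\<in>?X. real (card (paths (last (u # as)) (k + (n + r)) (?Q as))))"
    unfolding of_nat_sum[symmetric] of_nat_le_iff .
  also have "\<dots> \<le> (\<Sum>as\<in>?X. M1 * Z * M2)"
    by (intro sum_mono G) auto
  also have "\<dots> \<le> real (d ^ m) * (M1 * Z * M2)"
  proof -
    have "card ?X \<le> d ^ m"
      unfolding card_paths_True[OF u, symmetric] by (rule card_paths_mono) auto
    then have "real (card ?X) \<le> real (d ^ m)" by (rule of_nat_mono)
    then show ?thesis using M0 Z0 by (simp add: mult_right_mono)
  qed
  finally show ?thesis .
qed

section \<open>Cycle homomorphisms as closed walks\<close>

lemma card_cycle_maps: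
  assumes "t > 0"
  shows "card {f \<in> {0..<t} \<rightarrow>\<^sub>E V. Q (map f [0..<t]) \<and>
      (\<forall>x\<in>{0..<t}. \<forall>y\<in>{0..<t}. cycle_graph t x y \<longrightarrow> E (f x) (f y))}
    = (\<Sum>u\<in>V. card (paths u t (\<lambda>xs. last (u # xs) = u \<and> Q xs)))" (is "card ?H = _")
proof -
  \<comment> \<open>The list of values of \<open>f\<close> is a closed walk based at its last entry
    \<open>f (t - 1)\<close>, because \<open>path\<close> records only the vertices after the base
    point.\<close>
  let ?L = "{xs. length xs = t \<and> path E (last xs) xs \<and> Q xs}"
  \<comment> \<open>Symmetry of \<open>E\<close> reduces both orientations in
    \<open>cycle_graph\<close> to the steps from i to i + 1 mod t.\<close>
  have hom: "(\<forall>x\<in>{0..<t}. \<forall>y\<in>{0..<t}. cycle_graph t x y \<longrightarrow> E (f x) (f y)) \<longleftrightarrow>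
      (\<forall>i<t. E (f i) (f (Suc i mod t)))" (is "?A = ?B") for f
  proof
    assume ?A
    then have "E (f i) (f (Suc i mod t))" if "i < t" for i
      using that assms unfolding cycle_graph_def by (metis atLeastLessThan_iff le0 mod_less_divisor)
    then show ?B by blast
  next
    assume ?B
    then show ?A unfolding cycle_graph_def by (auto intro: edge_sym)
  qed
  have "bij_betw (\<lambda>f. map f [0..<t]) ?H ?L"
  proof (rule bij_betw_byWitness[where f' = "\<lambda>xs. restrict ((!) xs) {0..<t}"])
    show "\<forall>f\<in>?H. restrict ((!) (map f [0..<t])) {0..<t} = f"
      by (auto simp: fun_eq_iff PiE_iff extensional_def)
    show "\<forall>xs\<in>?L. map (restrict ((!) xs) {0..<t}) [0..<t] = xs"
      by (auto intro: nth_equalityI)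
    show "(\<lambda>f. map f [0..<t]) ` ?H \<subseteq> ?L"
      unfolding hom using assms by (auto simp: closed_path_conv_nth)
    show "(\<lambda>xs. restrict ((!) xs) {0..<t}) ` ?L \<subseteq> ?H"
    proof (rule image_subsetI)
      fix xs assume "xs \<in> ?L"
      then have xs: "path E (last xs) xs" "t = length xs" "Q xs" by auto
      have *: "map (restrict ((!) xs) {0..<t}) [0..<t] = xs"
        using xs(2) by (auto intro: nth_equalityI)
      show "restrict ((!) xs) {0..<t} \<in> ?H"
        unfolding mem_Collect_eq hom *
        using xs assms path_set[OF xs(1)] closed_path_conv_nth[of xs E] by auto
    qed
  qed
  then have "card ?H = card ?L" by (rule bij_betw_same_card)
  also have "?L = (\<Union>u\<in>V. paths u t (\<lambda>xs. last (u # xs) = u \<and> Q xs))"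
  proof -
    have "last (u # xs) = last xs" if "length xs = t" for u :: 'a and xs
      using that assms by auto
    moreover have "last xs \<in> V" if "path E (last xs) xs" "length xs = t" for xs
      using that assms path_set[OF that(1)] last_in_set[of xs] by auto
    ultimately show ?thesis unfolding paths_def by auto
  qed
  also have "card \<dots> = (\<Sum>u\<in>V. card (paths u t (\<lambda>xs. last (u # xs) = u \<and> Q xs)))"
  proof (intro card_UN_disjoint ballI impI finite_V finite_paths)
    show "paths u t (\<lambda>xs. last (u # xs) = u \<and> Q xs) \<inter> paths v t (\<lambda>xs. last (v # xs) = v \<and> Q xs) = {}"
      if "u \<noteq> v" for u v
      using assms that by (auto simp: paths_def)
  qed
  finally show ?thesis .
qed

lemma hom_count_cycle:
  "t > 0 \<Longrightarrow> hom_count {0..<t} (cycle_graph t) V E = (\<Sum>u\<in>V. walks t u u)"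
  using card_cycle_maps[of t "\<lambda>_. True"] by (simp add: hom_count_def walks_def)

lemma mon_count_cycle:
  "t > 0 \<Longrightarrow> mon_count {0..<t} (cycle_graph t) V E =
    (\<Sum>u\<in>V. card (paths u t (\<lambda>xs. last (u # xs) = u \<and> distinct xs)))"
  using card_cycle_maps[of t distinct] by (simp add: mon_count_def distinct_map)

end

subsection \<open>Mixing and the two regimes\<close>

context expander_graph
begin

lemma card_V_pos: "0 < card V"
  using nonempty finite_V by (simp add: card_gt_0_iff)

text \<open>\<open>adj\<close> preserves mean zero, so the spectral gap applies again at every
  step.\<close>

lemma adj_pow_sum_zero:
  assumes "sum f V = 0"
  shows "sum ((adj ^^ k) f) V = 0 \<and> nsq ((adj ^^ k) f) \<le> ((\<rho> * real d) ^ k)\<^sup>2 * nsq f"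
proof (induction k)
  case 0
  then show ?case using assms by simp
next
  case (Suc k)
  have "nsq (adj ((adj ^^ k) f)) \<le> (\<rho> * real d)\<^sup>2 * nsq ((adj ^^ k) f)"
    using Suc by (intro spectral_gap) simp
  also have "\<dots> \<le> (\<rho> * real d)\<^sup>2 * (((\<rho> * real d) ^ k)\<^sup>2 * nsq f)"
    using Suc by (intro mult_left_mono) auto
  finally show ?case using Suc by (simp add: sum_adj power_mult_distrib mult_ac)
qed

text \<open>Subtract from the indicator of \<open>v\<close> its mean 1/N, where N =
  \<open>card V\<close>. The constant part is multiplied by exactly \<open>d\<close> per step and
  gives d^k / N. The rest has norm at most 1 and mean zero, so the gap bounds its image, and a value
  at a point is at most the norm.\<close>

lemma walks_approx:
  assumes u: "u \<in> V" and v: "v \<in> V"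
  shows "\<bar>real (walks k u v) - real d ^ k / card V\<bar> \<le> (\<rho> * real d) ^ k"
proof -
  define \<phi> :: "'a \<Rightarrow> real" where "\<phi> x = of_bool (x = v)" for x
  define g where "g x = \<phi> x - 1 / card V" for x
  have sum_phi: "sum \<phi> V = 1"
    using v finite_V by (simp add: \<phi>_def of_bool_def)
  have "nsq \<phi> = sum \<phi> V"
    unfolding nsq_def by (rule sum.cong) (auto simp: \<phi>_def)
  then have nsq_phi: "nsq \<phi> = 1" by (simp add: sum_phi)
  have sum_g: "sum g V = 0"
    using card_V_pos by (simp add: g_def sum_subtractf sum_phi)
  have "\<phi> = (\<lambda>x. g x + 1 / card V)" by (simp add: g_def)
  then have "nsq \<phi> = nsq g + nsq (\<lambda>_. 1 / card V)"
    by (simp only: nsq_add sum_distrib_right[symmetric] sum_g)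
  then have nsq_g: "nsq g \<le> 1"
    using nsq_phi nsq_nonneg[of "\<lambda>_. 1 / card V"] by simp
  have "(adj ^^ k) g x = (adj ^^ k) \<phi> x - real d ^ k / card V" if "x \<in> V" for x
    using that
  proof (induction k arbitrary: x)
    case (Suc k)
    have "(adj ^^ Suc k) g x = adj (\<lambda>y. (adj ^^ k) \<phi> y - real d ^ k / card V) x"
      unfolding funpow.simps o_apply by (rule adj_cong) (rule Suc.IH)
    then show ?case using Suc.prems by (simp add: adj_diff adj_const)
  qed (simp add: g_def)
  from this[OF u] have "real (walks k u v) - real d ^ k / card V = (adj ^^ k) g u"
    unfolding walks_eq_adj_pow \<phi>_def by simp
  moreover have "\<bar>(adj ^^ k) g u\<bar> \<le> (\<rho> * real d) ^ k"
  proof (rule power2_le_imp_le)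
    have "((adj ^^ k) g u)\<^sup>2 \<le> ((\<rho> * real d) ^ k)\<^sup>2 * nsq g"
      using sq_le_nsq[OF u] adj_pow_sum_zero[OF sum_g] by (rule order_trans[OF _ conjunct2])
    also have "\<dots> \<le> ((\<rho> * real d) ^ k)\<^sup>2 * 1"
      using nsq_g by (intro mult_left_mono) auto
    finally show "\<bar>(adj ^^ k) g u\<bar>\<^sup>2 \<le> ((\<rho> * real d) ^ k)\<^sup>2" by simp
    show "0 \<le> (\<rho> * real d) ^ k" using delta by simp
  qed
  ultimately show ?thesis by simp
qed

text \<open>The error (\<rho> d)^k is N \<rho>^k times the main term d^k / N, so
  \<open>\<eta>\<close> bounds the relative error.\<close>

lemma walks_bounds:
  assumes "u \<in> V" "v \<in> V" and mix: "card V * \<rho> ^ k \<le> \<eta>"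
  shows "real (walks k u v) \<le> real d ^ k * (1 + \<eta>) / card V"
    and "real d ^ k * (1 - \<eta>) / card V \<le> real (walks k u v)"
proof -
  have "(\<rho> * real d) ^ k = real d ^ k * (card V * \<rho> ^ k) / card V"
    using card_V_pos by (simp add: power_mult_distrib)
  also have "\<dots> \<le> real d ^ k * \<eta> / card V"
    using mix by (intro divide_right_mono mult_left_mono) auto
  finally have "\<bar>real (walks k u v) - real d ^ k / card V\<bar> \<le> real d ^ k * \<eta> / card V"
    using walks_approx[OF assms(1,2), of k] by linarith
  then show "real (walks k u v) \<le> real d ^ k * (1 + \<eta>) / card V"
    and "real d ^ k * (1 - \<eta>) / card V \<le> real (walks k u v)"
    by (simp_all add: abs_le_iff algebra_simps add_divide_distrib diff_divide_distrib)
qed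

text \<open>By \<open>nsq_adj_vanishing_on\<close> each step costs the factor \<open>?b\<close> in
  the squared norm. Cauchy-Schwarz passes from the squared norm to the sum, and the square root puts
  the 2 into the exponent's denominator.\<close>

lemma sum_paths_avoid:
  assumes S: "S \<subseteq> V"
  shows "(\<Sum>w\<in>V. real (card (paths w m (\<lambda>xs. set xs \<inter> S = {}))))
    \<le> card V * real d ^ m * exp (- (\<delta> * card S * m / (2 * card V)))"
proof (rule power2_le_imp_le)
  let ?T = "\<lambda>f. adj (\<lambda>x. of_bool (x \<notin> S) * f x)"
  let ?b = "1 - \<delta> * card S / card V"
  have "card S \<le> card V" using S finite_V by (rule card_mono[rotated])
  then have "\<delta> * card S \<le> 1 * real (card V)"
    using delta by (intro mult_mono) auto
  then have b: "0 \<le> ?b" using card_V_pos by simp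
  have nsq_T: "nsq ((?T ^^ m) (\<lambda>_. 1)) \<le> ((real d)\<^sup>2 * ?b) ^ m * card V"
  proof (induction m)
    case 0
    then show ?case by (simp add: nsq_def)
  next
    case (Suc m)
    let ?g = "(?T ^^ m) (\<lambda>_. 1)"
    have "nsq (?T ?g) \<le> (real d)\<^sup>2 * ?b * nsq (\<lambda>x. of_bool (x \<notin> S) * ?g x)"
      using S by (intro nsq_adj_vanishing_on) auto
    also have "\<dots> \<le> (real d)\<^sup>2 * ?b * nsq ?g"
      using b by (intro mult_left_mono) (auto simp: nsq_def intro!: sum_mono)
    also have "\<dots> \<le> (real d)\<^sup>2 * ?b * (((real d)\<^sup>2 * ?b) ^ m * card V)"
      using b Suc by (intro mult_left_mono) auto
    finally show ?case by (simp add: mult.assoc)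
  qed
  have "?b ^ m \<le> exp (- (\<delta> * card S / card V)) ^ m"
    using b exp_ge_add_one_self[of "- (\<delta> * card S / card V)"] by (intro power_mono) auto
  also have "\<dots> = (exp (- (\<delta> * card S * m / (2 * card V))))\<^sup>2"
    by (simp add: exp_of_nat_mult[symmetric] exp_double[symmetric])
  finally have b_exp: "?b ^ m \<le> (exp (- (\<delta> * card S * m / (2 * card V))))\<^sup>2" .
  have "(\<Sum>w\<in>V. real (card (paths w m (\<lambda>xs. set xs \<inter> S = {}))))\<^sup>2
      = (\<Sum>w\<in>V. (?T ^^ m) (\<lambda>_. 1) w * 1)\<^sup>2"
    by (simp only: card_paths_avoid mult_1_right)
  also have "\<dots> \<le> nsq ((?T ^^ m) (\<lambda>_. 1)) * (\<Sum>w\<in>V. 1\<^sup>2)"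
    unfolding nsq_def by (rule Cauchy_Schwarz_ineq_sum)
  also have "\<dots> \<le> ((real d)\<^sup>2 * ?b) ^ m * card V * card V"
    using nsq_T by (simp add: mult_right_mono)
  also have "\<dots> = (card V * real d ^ m)\<^sup>2 * ?b ^ m"
  proof -
    have "((real d)\<^sup>2) ^ m = (real d ^ m)\<^sup>2" by (metis power_mult mult.commute)
    then show ?thesis by (simp only: power_mult_distrib power2_eq_square mult_ac)
  qed
  also have "\<dots> \<le> (card V * real d ^ m)\<^sup>2 * (exp (- (\<delta> * card S * m / (2 * card V))))\<^sup>2"
    by (intro mult_left_mono b_exp) auto
  finally show "(\<Sum>w\<in>V. real (card (paths w m (\<lambda>xs. set xs \<inter> S = {}))))\<^sup>2
      \<le> (card V * real d ^ m * exp (- (\<delta> * card S * m / (2 * card V))))\<^sup>2"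
    by (simp add: power_mult_distrib)
qed simp

lemma hom_count_cycle_ge:
  assumes "t > 0" "card V * \<rho> ^ t \<le> \<eta>"
  shows "real d ^ t * (1 - \<eta>) \<le> real (hom_count {0..<t} (cycle_graph t) V E)"
proof -
  have "real d ^ t * (1 - \<eta>) = (\<Sum>u\<in>V. real d ^ t * (1 - \<eta>) / card V)"
    using card_V_pos by simp
  also have "\<dots> \<le> (\<Sum>u\<in>V. real (walks t u u))"
    using assms by (intro sum_mono walks_bounds)
  finally show ?thesis using assms(1) by (simp add: hom_count_cycle)
qed

text \<open>Each of the N base points starts at most d (d - 1)^n non-backtracking walks, and each of
  these is closed by at most (1 + \<eta>) d^k / N segments. The loss (1 - 1/d)^n is at most exp (- n
  / d).\<close>

lemma mon_count_cycle_le_degree: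
  assumes "k > 0" and mix: "card V * \<rho> ^ k \<le> \<eta>"
  shows "real (mon_count {0..<Suc n + k} (cycle_graph (Suc n + k)) V E)
    \<le> real d ^ (Suc n + k) * (1 + \<eta>) * exp (- (n / d))"
proof -
  let ?M = "real d ^ k * (1 + \<eta>) / card V"
  have "0 \<le> card V * \<rho> ^ k" using delta by simp
  with mix have eta: "0 \<le> \<eta>" by linarith
  have "real (mon_count {0..<Suc n + k} (cycle_graph (Suc n + k)) V E)
      = (\<Sum>u\<in>V. real (card (paths u (Suc n + k) (\<lambda>xs. last (u # xs) = u \<and> distinct xs))))"
    by (subst mon_count_cycle) auto
  also have "\<dots> \<le> (\<Sum>u\<in>V. real (d * (d - 1) ^ n) * ?M)"
    using assms by (intro sum_mono closed_distinct_le_nonbacktracking walks_bounds)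
  also have "\<dots> = real d ^ Suc k * (1 + \<eta>) * (real d - 1) ^ n"
    using card_V_pos degree_pos by (simp add: of_nat_diff)
  also have "\<dots> \<le> real d ^ Suc k * (1 + \<eta>) * (real d ^ n * exp (- (n / d)))"
  proof (intro mult_left_mono)
    have "real d - 1 = real d * (1 - 1 / d)"
      using degree_pos by (simp add: field_simps)
    then have "(real d - 1) ^ n = real d ^ n * (1 - 1 / d) ^ n"
      by (simp only: power_mult_distrib)
    also have "\<dots> \<le> real d ^ n * exp (- (1 / d)) ^ n"
      using degree_pos exp_ge_add_one_self[of "- (1 / real d)"]
      by (intro mult_left_mono power_mono) auto
    also have "exp (- (1 / d)) ^ n = exp (- (n / d))"
      by (simp flip: exp_of_nat_mult)
    finally show "(real d - 1) ^ n \<le> real d ^ n * exp (- (n / d))" .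
  qed (use eta in auto)
  finally show ?thesis by (simp add: power_add mult_ac)
qed

text \<open>As in the birthday paradox, two segments of length \<open>m\<close> tend to meet once
  m^2 reaches order N. The first segment supplies the avoided set of size \<open>m\<close> and the
  third makes \<open>m\<close> steps off it, whence the square; the segments of length
  \<open>k\<close> and \<open>r\<close> mix.\<close>

lemma mon_count_cycle_le_birthday:
  fixes k m r t :: nat
  assumes t: "t = m + (k + (m + r))" "t > 0"
    and mix: "card V * \<rho> ^ k \<le> \<eta>" "card V * \<rho> ^ r \<le> \<eta>"
  shows "real (mon_count {0..<t} (cycle_graph t) V E)
    \<le> real d ^ t * (1 + \<eta>)\<^sup>2 * exp (- (\<delta> * (real m)\<^sup>2 / (2 * card V)))"
proof -
  let ?M = "\<lambda>k. real d ^ k * (1 + \<eta>) / card V"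
  let ?Z = "card V * real d ^ m * exp (- (\<delta> * (real m)\<^sup>2 / (2 * card V)))"
  have "real (mon_count {0..<t} (cycle_graph t) V E)
      = (\<Sum>u\<in>V. real (card (paths u t (\<lambda>xs. last (u # xs) = u \<and> distinct xs))))"
    using t(2) by (simp add: mon_count_cycle)
  also have "\<dots> \<le> (\<Sum>u\<in>V. real (d ^ m) * (?M k * ?Z * ?M r))"
  proof (unfold t(1), intro sum_mono closed_distinct_le_avoiding walks_bounds mix)
    fix S assume "S \<subseteq> V" "card S = m"
    then show "(\<Sum>w\<in>V. real (card (paths w m (\<lambda>xs. set xs \<inter> S = {})))) \<le> ?Z"
      using sum_paths_avoid[of S m] by (simp add: power2_eq_square mult.assoc)
  qed auto
  also have "\<dots> = real d ^ t * (1 + \<eta>)\<^sup>2 * exp (- (\<delta> * (real m)\<^sup>2 / (2 * card V)))"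
    using card_V_pos by (simp add: t(1) power_add power2_eq_square)
  finally show ?thesis .
qed

text \<open>Either t > c d or t > c sqrt N, and both bounds lose at least the factor
  \<open>q\<close>: c / 2 comes from n >= t / 2, and 128 = 2 * 64 from m >= t / 8.
  \<open>\<eta>\<close> is so small against 1 - q that the mixing errors in both counts still leave
  the factor 1 - (1 - q) / 2.\<close>

lemma mon_count_cycle_less:
  fixes c \<eta> q :: real
  defines "q \<equiv> exp (- min (c / 2) (\<delta> * c\<^sup>2 / 128))"
  assumes c: "c > 0" and eta: "\<eta> = (1 - q) / 16"
    and t12: "t \<ge> 12" and t: "real t > c * min (sqrt (card V)) d"
    and mix: "card V * \<rho> ^ (t div 4) \<le> \<eta>"
  shows "real (mon_count {0..<t} (cycle_graph t) V E)
    < (1 - (1 - q) / 2) * real (hom_count {0..<t} (cycle_graph t) V E)"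
proof -
  have q: "0 < q" "q < 1" using c delta by (auto simp: q_def)
  then have eta_pos: "\<eta> > 0" by (simp add: eta)
  have mix': "card V * \<rho> ^ j \<le> \<eta>" if "t div 4 \<le> j" for j
  proof -
    have "card V * \<rho> ^ j \<le> card V * \<rho> ^ (t div 4)"
      using delta that by (intro mult_left_mono power_decreasing) auto
    with mix show ?thesis by linarith
  qed
  have "real (mon_count {0..<t} (cycle_graph t) V E) \<le> real d ^ t * (1 + \<eta>)\<^sup>2 * q"
  proof (cases "c * d < t")
    case True
    \<comment> \<open>The last \<open>t div 4\<close> steps close the walk; for the others t >= 12
      gives n >= t / 2.\<close>
    define n where "n = t - t div 4 - 1"
    have tn: "t = Suc n + t div 4" "real t \<le> 2 * real n"
      using t12 by (auto simp: n_def)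
    have "real (mon_count {0..<t} (cycle_graph t) V E)
        \<le> real d ^ t * (1 + \<eta>) * exp (- (n / d))"
      using mon_count_cycle_le_degree[of "t div 4" \<eta> n] mix t12 unfolding tn(1)[symmetric] by simp
    also have "\<dots> \<le> real d ^ t * (1 + \<eta>)\<^sup>2 * q"
    proof (intro mult_mono mult_left_mono)
      show "1 + \<eta> \<le> (1 + \<eta>)\<^sup>2" using eta_pos by (intro self_le_power) auto
      have "c / 2 \<le> n / d" using True tn degree_pos by (simp add: field_simps)
      then have "min (c / 2) (\<delta> * c\<^sup>2 / 128) \<le> n / d" by (rule min.coboundedI1)
      then show "exp (- (n / d)) \<le> q" by (simp only: q_def exp_le_cancel_iff neg_le_iff_le)
    qed (use eta_pos in auto)
    finally show ?thesis .
  next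
    case False
    then have *: "c * sqrt (card V) < t" using t c by (simp add: min_def split: if_splits)
    define m where "m = t div 4"
    \<comment> \<open>From t >= 12 follows m >= 3, hence t <= 4 m + 3 <= 8 m.\<close>
    have m: "real t \<le> 8 * real m" using t12 by (simp add: m_def)
    have "(c * sqrt (card V))\<^sup>2 \<le> (8 * real m)\<^sup>2"
      using * m c by (intro power_mono) auto
    then have "c\<^sup>2 * card V \<le> 64 * (real m)\<^sup>2" by (simp add: power_mult_distrib)
    then have "\<delta> * (c\<^sup>2 * card V) \<le> \<delta> * (64 * (real m)\<^sup>2)"
      using delta by (intro mult_left_mono) auto
    then have "\<delta> * c\<^sup>2 / 128 \<le> \<delta> * (real m)\<^sup>2 / (2 * card V)"
      using card_V_pos by (simp add: field_simps)
    then have "min (c / 2) (\<delta> * c\<^sup>2 / 128) \<le> \<delta> * (real m)\<^sup>2 / (2 * card V)"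
      by (rule min.coboundedI2)
    then have "exp (- (\<delta> * (real m)\<^sup>2 / (2 * card V))) \<le> q"
      by (simp only: q_def exp_le_cancel_iff neg_le_iff_le)
    then have "real d ^ t * (1 + \<eta>)\<^sup>2 * exp (- (\<delta> * (real m)\<^sup>2 / (2 * card V))) \<le> real d ^ t * (1 + \<eta>)\<^sup>2 * q"
      by (intro mult_left_mono) auto
    \<comment> \<open>The fourth segment takes the remainder of the division by 4, so it is at least
      as long as the second and mixes too.\<close>
    moreover have "real (mon_count {0..<t} (cycle_graph t) V E)
        \<le> real d ^ t * (1 + \<eta>)\<^sup>2 * exp (- (\<delta> * (real m)\<^sup>2 / (2 * card V)))"
      by (rule mon_count_cycle_le_birthday[where k = "t div 4" and r = "t - 3 * (t div 4)"])
        (use t12 in \<open>auto simp: m_def intro!: mix'\<close>)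
    ultimately show ?thesis by linarith
  qed
  also have "\<dots> < real d ^ t * ((1 - (1 - q) / 2) * (1 - \<eta>))"
  proof -
    \<comment> \<open>To first order in s = 1 - q the left side loses 14/16 s and the right side
      only 9/16 s; the higher terms have the favourable sign.\<close>
    define s where "s = 1 - q"
    have s: "0 < s" "s < 1" "q = 1 - s" "\<eta> = s / 16" using q by (auto simp: s_def eta)
    have s2: "0 < s * s" "s * s < s" "0 < s * s * s" using s by auto
    have "(1 + \<eta>)\<^sup>2 * q = 1 - 14/16 * s - 31/256 * (s * s) - 1/256 * (s * s * s)"
      unfolding s(3,4) by (simp add: power2_eq_square field_simps)
    also have "\<dots> < 1 - 9/16 * s + 1/32 * (s * s)" using s s2 by linarith
    also have "\<dots> = (1 - (1 - q) / 2) * (1 - \<eta>)"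
      unfolding s(3,4) by (simp add: field_simps)
    finally show ?thesis using degree_pos by (simp add: mult.assoc)
  qed
  also have "\<dots> = (1 - (1 - q) / 2) * (real d ^ t * (1 - \<eta>))" by simp
  also have "\<dots> \<le> (1 - (1 - q) / 2) * real (hom_count {0..<t} (cycle_graph t) V E)"
    using q t12 by (intro mult_left_mono hom_count_cycle_ge mix') auto
  finally show ?thesis .
qed

end

section \<open>From the adjacency matrix to the expander locale\<close>

lemma eigenvalue_adj_mat:
  fixes f :: "nat \<Rightarrow> real"
  assumes v: "v \<in> {1..N}" "f v \<noteq> 0"
    and eig: "\<And>u. u \<in> {1..N} \<Longrightarrow> (\<Sum>v\<in>{1..N}. of_bool (E u v) * f v) = \<mu> * f u"
  shows "eigenvalue (adj_mat N E) \<mu>"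
proof -
  \<comment> \<open>Vertices run from 1 to N, vector indices from 0 to N - 1; hence the shift by
    \<open>Suc\<close>.\<close>
  let ?w = "vec N (\<lambda>i. f (Suc i))"
  obtain i where i: "v = Suc i" "i < N" using v(1) by (cases v) auto
  then have "?w $ i \<noteq> 0\<^sub>v N $ i" using v(2) by simp
  then have "?w \<noteq> 0\<^sub>v N" by metis
  moreover have "adj_mat N E *\<^sub>v ?w = \<mu> \<cdot>\<^sub>v ?w"
  proof (rule eq_vecI)
    fix i assume "i < dim_vec (\<mu> \<cdot>\<^sub>v ?w)"
    then have i: "i < N" by simp
    have "(adj_mat N E *\<^sub>v ?w) $ i = (\<Sum>j\<in>{0..<N}. row (adj_mat N E) i $ j * ?w $ j)"
      using i by (simp add: adj_mat_def scalar_prod_def)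
    also have "\<dots> = (\<Sum>j\<in>{0..<N}. of_bool (E (Suc i) (Suc j)) * f (Suc j))"
      using i by (intro sum.cong) (simp_all add: adj_mat_def)
    also have "\<dots> = (\<Sum>v\<in>{1..N}. of_bool (E (Suc i) v) * f v)"
      by (rule sum.reindex_bij_witness[of _ "\<lambda>v. v - 1" Suc]) auto
    also have "\<dots> = \<mu> * f (Suc i)" using i by (intro eig) simp
    finally show "(adj_mat N E *\<^sub>v ?w) $ i = (\<mu> \<cdot>\<^sub>v ?w) $ i" using i by simp
  qed (simp add: adj_mat_def)
  ultimately show ?thesis
    unfolding eigenvalue_def eigenvector_def by (intro exI[of _ ?w]) (simp add: adj_mat_def)
qed

text \<open>Maximum principle: at a maximum of \<open>f\<close> the eigenvalue equation forces all neighbours to be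
  maxima as well.\<close>
lemma (in regular_graph) degree_eigenvector_const:
  assumes eig: "\<And>u. u \<in> V \<Longrightarrow> adj f u = real d * f u"
    and conn: "\<And>u v. u \<in> V \<Longrightarrow> v \<in> V \<Longrightarrow> E\<^sup>*\<^sup>* u v" and "V \<noteq> {}"
  obtains a where "\<And>v. v \<in> V \<Longrightarrow> f v = a"
proof -
  have "Max (f ` V) \<in> f ` V" using finite_V \<open>V \<noteq> {}\<close> by simp
  then obtain u where "u \<in> V" "f u = Max (f ` V)" by auto
  then have u: "u \<in> V" "\<And>v. v \<in> V \<Longrightarrow> f v \<le> f u"
    using finite_V by auto
  have step: "f y = f u" if y: "E x y" and x: "x \<in> V" "f x = f u" for x y
  proof -
    have "(\<Sum>v | E x v. f u - f v) = 0"
      using eig[OF x(1)] degree[OF x(1)] x(2) by (simp add: adj_eq sum_subtractf)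
    moreover have "0 \<le> f u - f v" if "v \<in> {v. E x v}" for v
      using that u(2) by (auto dest: edge_V)
    ultimately have "\<forall>v\<in>{v. E x v}. f u - f v = 0"
      using sum_nonneg_eq_0_iff[OF finite_nbrs, of x "\<lambda>v. f u - f v"] by blast
    with y show ?thesis by simp
  qed
  have "v \<in> V \<and> f v = f u" if "E\<^sup>*\<^sup>* u v" for v
    using that by induction (use u step in \<open>auto dest: edge_V\<close>)
  with conn u(1) that show ?thesis by blast
qed

text \<open>The matrix bound leaves out only the eigenvalue \<open>d\<close>. By connectedness its
  eigenfunctions are constant, and a constant of mean zero vanishes, so every nonzero mean-zero
  eigenfunction falls under the bound.\<close>

lemma expander_graph_of_adj_mat:
  fixes \<delta> :: real
  assumes "simple_graph_on N E" "connected_on N E" "regular_on N E d" "N > 0" "d > 0"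
    and delta: "0 < \<delta>" "\<delta> \<le> 1"
    and spec: "\<And>\<mu>. eigenvalue (adj_mat N E) \<mu> \<Longrightarrow> \<mu> \<noteq> real d \<Longrightarrow> \<bar>\<mu>\<bar> / real d < 1 - \<delta>"
  shows "expander_graph {1..N} E d \<delta>"
proof -
  interpret regular_graph "{1..N}" E d
  proof
    show "card {v. E u v} = d" if "u \<in> {1..N}" for u
    proof -
      have "{v. E u v} = {v \<in> {1..N}. E u v}"
        using assms(1) by (auto simp: simple_graph_on_def)
      then show ?thesis using that assms(3) by (simp add: regular_on_def)
    qed
  qed (use assms(1) in \<open>auto simp: simple_graph_on_def\<close>)
  show ?thesis
  proof unfold_locales
    fix f :: "nat \<Rightarrow> real" and \<mu> v
    assume f: "sum f {1..N} = 0" "v \<in> {1..N}" "f v \<noteq> 0"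
      and eig: "\<And>u. u \<in> {1..N} \<Longrightarrow> adj f u = \<mu> * f u"
    have "\<mu> \<noteq> real d"
    proof
      assume "\<mu> = real d"
      then obtain a where a: "\<And>v. v \<in> {1..N} \<Longrightarrow> f v = a"
        using degree_eigenvector_const[of f] eig assms(2) f(2) unfolding connected_on_def by blast
      then have "sum f {1..N} = N * a" by simp
      with f a show False using \<open>N > 0\<close> by simp
    qed
    moreover have "eigenvalue (adj_mat N E) \<mu>"
      using f(2,3) eig unfolding adj_def by (rule eigenvalue_adj_mat)
    ultimately show "\<bar>\<mu>\<bar> \<le> (1 - \<delta>) * real d"
      using spec[of \<mu>] \<open>d > 0\<close> by (simp add: field_simps)
  qed (use assms in auto)
qed

section \<open>Asymptotics and conclusion\<close>

lemma eventually_ln_affine_le: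
  fixes f :: "nat \<Rightarrow> real"
  assumes f: "filterlim (\<lambda>n. f n / ln (real n)) at_top sequentially" and c: "c > 0"
  shows "\<forall>\<^sub>F n in sequentially. a * ln (real n) + b \<le> c * f n"
proof -
  have "\<forall>\<^sub>F n in sequentially. (\<bar>a\<bar> + \<bar>b\<bar>) / c \<le> f n / ln (real n)"
    using f by (auto simp: filterlim_at_top)
  moreover have "\<forall>\<^sub>F n in sequentially. 1 \<le> ln (real n)" by real_asymp
  ultimately show ?thesis
  proof eventually_elim
    case (elim n)
    have "a * ln (real n) \<le> \<bar>a\<bar> * ln (real n)"
      using elim by (intro mult_right_mono) auto
    \<comment> \<open>Once ln n >= 1, the constant \<open>b\<close> is absorbed into a multiple of
      ln n.\<close>
    moreover have "\<bar>b\<bar> * 1 \<le> \<bar>b\<bar> * ln (real n)"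
      using elim by (intro mult_left_mono) auto
    ultimately have "a * ln (real n) + b \<le> (\<bar>a\<bar> + \<bar>b\<bar>) * ln (real n)"
      by (simp add: distrib_right)
    also have "\<dots> \<le> c * f n"
      using elim c by (simp add: field_simps)
    finally show ?case .
  qed
qed

theorem theorem4:
  fixes G :: "nat \<Rightarrow> nat \<Rightarrow> nat \<Rightarrow> bool" and N1 :: "nat \<Rightarrow> nat"
  assumes graphs: "\<forall>\<^sub>F N in sequentially.
      simple_graph_on N (G N) \<and> connected_on N (G N) \<and> \<not> bipartite_on N (G N) \<and>
      regular_on N (G N) (N1 N)"
    and expander: "spectral_expander G N1"
    and degree: "filterlim (\<lambda>N. real (N1 N) / ln (real N)) at_top sequentially"
  shows "\<forall>c>0. \<exists>\<epsilon>>0. \<forall>\<^sub>F N in sequentially. \<forall>t::nat.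
      real t > c * min (sqrt (real N)) (real (N1 N)) \<longrightarrow>
      real (mon_count {0..<t} (cycle_graph t) {1..N} (G N))
        < (1 - \<epsilon>) * real (hom_count {0..<t} (cycle_graph t) {1..N} (G N))"
proof (intro allI impI)
  fix c :: real assume c: "c > 0"
  obtain \<delta>0 where "\<delta>0 > 0" and spec0: "\<forall>\<^sub>F N in sequentially.
      \<forall>\<mu>. eigenvalue (adj_mat N (G N)) \<mu> \<and> \<mu> \<noteq> real (N1 N) \<longrightarrow> \<bar>\<mu>\<bar> / real (N1 N) < 1 - \<delta>0"
    using expander unfolding spectral_expander_def by auto
  \<comment> \<open>Capping at 1 only weakens the gap and keeps 1 - \<delta> nonnegative.\<close>
  define \<delta> where "\<delta> = min \<delta>0 1"
  have delta: "0 < \<delta>" "\<delta> \<le> 1" "\<delta> \<le> \<delta>0" using \<open>\<delta>0 > 0\<close> by (auto simp: \<delta>_def)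
  define q where "q = exp (- min (c / 2) (\<delta> * c\<^sup>2 / 128))"
  define \<eta> where "\<eta> = (1 - q) / 16"
  have q: "0 < q" "q < 1" using c delta by (auto simp: q_def)
  then have eta: "0 < \<eta>" "\<eta> \<le> 1" by (auto simp: \<eta>_def)
  \<comment> \<open>\<open>K N\<close> is the mixing length: since (1 - \<delta>)^k <= exp (-
    \<delta> k), every k >= \<open>K N\<close> makes N (1 - \<delta>)^k at most \<eta>.\<close>
  define K where "K N = (ln (real N) + ln (1 / \<eta>)) / \<delta>" for N
  have K_eq: "4 * K N + 12 = 4 / \<delta> * ln (real N) + (4 * ln (1 / \<eta>) / \<delta> + 12)" for N
    by (simp add: K_def add_divide_distrib)
  \<comment> \<open>Whichever term attains the minimum, t >= 4 \<open>K N\<close> + 12 follows,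
    hence \<open>t div 4\<close> >= \<open>K N\<close> and t >= 12. For the degree this rests on its
    growth faster than ln N.\<close>
  have large_sqrt: "\<forall>\<^sub>F N in sequentially. 4 * K N + 12 \<le> c * sqrt (real N)"
    unfolding K_eq by (rule eventually_ln_affine_le[OF _ c]) real_asymp
  have large_deg: "\<forall>\<^sub>F N in sequentially. 4 * K N + 12 \<le> c * real (N1 N)"
    unfolding K_eq by (rule eventually_ln_affine_le[OF degree c])
  have "\<forall>\<^sub>F N in sequentially. \<forall>t::nat.
      real t > c * min (sqrt (real N)) (real (N1 N)) \<longrightarrow>
      real (mon_count {0..<t} (cycle_graph t) {1..N} (G N))
        < (1 - (1 - q) / 2) * real (hom_count {0..<t} (cycle_graph t) {1..N} (G N))"
    using graphs spec0 large_sqrt large_deg eventually_gt_at_top[of 0]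
  proof eventually_elim
    case (elim N)
    have K_nonneg: "0 \<le> K N" using elim eta delta by (simp add: K_def)
    then have "0 < 4 * K N + 12" by simp
    also note elim(4)
    finally have "0 < c * real (N1 N)" .
    then have "N1 N > 0" using c by (simp add: zero_less_mult_iff)
    interpret expander_graph "{1..N}" "G N" "N1 N" \<delta>
    proof (rule expander_graph_of_adj_mat)
      fix \<mu> assume "eigenvalue (adj_mat N (G N)) \<mu>" "\<mu> \<noteq> real (N1 N)"
      with elim have "\<bar>\<mu>\<bar> / real (N1 N) < 1 - \<delta>0" by blast
      with delta show "\<bar>\<mu>\<bar> / real (N1 N) < 1 - \<delta>" by linarith
    qed (use elim delta \<open>N1 N > 0\<close> in auto)
    show ?case
    proof (intro allI impI)
      fix t assume t: "real t > c * min (sqrt (real N)) (real (N1 N))"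
      then have t_large: "real t \<ge> 4 * K N + 12"
        using elim by (simp add: min_def split: if_splits)
      then have "real t \<ge> 12" using K_nonneg by linarith
      then have "t \<ge> 12" by linarith
      define k where "k = t div 4"
      have "real t \<le> 4 * real k + 3" unfolding k_def by linarith
      then have "K N \<le> real k" using t_large by linarith
      then have k: "ln (real N) + ln (1 / \<eta>) \<le> \<delta> * real k"
        using delta by (simp add: K_def field_simps)
      have "(1 - \<delta>) ^ k \<le> exp (- \<delta>) ^ k"
        using delta exp_ge_add_one_self[of "- \<delta>"] by (intro power_mono) auto
      also have "\<dots> = exp (- (\<delta> * real k))" by (simp add: mult.commute flip: exp_of_nat_mult)
      also have "\<dots> \<le> exp (- (ln (real N) + ln (1 / \<eta>)))" using k by simp
      also have "\<dots> = \<eta> / real N"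
        using elim eta by (simp add: exp_diff exp_minus ln_div exp_add)
      finally have "card {1..N} * (1 - \<delta>) ^ k \<le> \<eta>"
        using elim by (simp add: field_simps)
      then show "real (mon_count {0..<t} (cycle_graph t) {1..N} (G N))
        < (1 - (1 - q) / 2) * real (hom_count {0..<t} (cycle_graph t) {1..N} (G N))"
        unfolding q_def k_def
        by (intro mon_count_cycle_less[where \<eta> = \<eta>] c)
          (use t \<open>t \<ge> 12\<close> in \<open>simp_all add: \<eta>_def q_def\<close>)
    qed
  qed
  then show "\<exists>\<epsilon>>0. \<forall>\<^sub>F N in sequentially. \<forall>t::nat.
      real t > c * min (sqrt (real N)) (real (N1 N)) \<longrightarrow>
      real (mon_count {0..<t} (cycle_graph t) {1..N} (G N))
        < (1 - \<epsilon>) * real (hom_count {0..<t} (cycle_graph t) {1..N} (G N))"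
    using q by (intro exI[of _ "(1 - q) / 2"]) auto
qed

end
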